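(* Let $f,g:\mathbb{R}^n\to[0,\infty)$ be measurable. Suppose that $(g_k)_{k\ge1}\subseteq C_0(\mathbb{R}^n)$ is a non-increasing sequence of functions converging pointwise to $g$, and that $N^{1}(f,g)<\infty$. Then $$M^{1}(f,g_-)=N^{1}(f,g)=\lim_{k\to\infty}N^{1}(f,g_k).$$ Moreover, there exists a covering measure $\mu$ of $f$ by $g$, that is, a non-negative Borel measure $\mu$ on $\mathbb{R}^n$ with $\mu*g\ge f$ everywhere, such that $\mu(\mathbb{R}^n)=N^{1}(f,g)$.
   Context: $C_0(\mathbb{R}^n)$ is the space of continuous real-valued functions on $\mathbb{R}^n$ vanishing at infinity. For a function $u$ on $\mathbb{R}^n$, $u_-(x)=u(-x)$. For a non-negative Borel measure $\mu$ and a measurable function $g\ge 0$, $(\mu*g)(x)=\int g(x-t)\,d\mu(t)$. For measurable $f,g:\mathbb{R}^n\to[0,\infty)$ define $$N^1(f,g)=\inf\{\mu(\mathbb{R}^n):\ \mu*g\ge f \text{ everywhere on }\mathbb{R}^n\},\qquad M^1(f,g)=\sup\Big\{\int f\,d\rho:\ \rho*g\le 1\text{ everywhere on }\mathbb{R}^n\Big\},$$ where the infimum and supremum are over all non-negative Borel measures on $\mathbb{R}^n$ (with $\inf\emptyset=+\infty$).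
   Formalization: In the definition of M^1 the supremum is taken over sigma-finite non-negative Borel measures only; over all Borel measures the equality M^1(f,g_-)=N^1(f,g) fails, e.g. for f=1_[0,1], g=1_K with K compact, nowhere dense, of positive Lebesgue measure. *)

theory Defs
  imports "HOL-Analysis.Analysis"
begin

definition C0_functions :: "('a::euclidean_space \<Rightarrow> real) set" where
  "C0_functions = {h. continuous_on UNIV h \<and> (h \<longlongrightarrow> 0) at_infinity}"

text \<open>
  Measures take values in \<open>[0, \<infinity>]\<close>. The type \<^typ>\<open>'a measure\<close> carries its own sigma-algebra,
  so this predicate says that it is the Borel one (whence the underlying space is \<open>UNIV\<close>).
\<close>
definition borel_measure :: "'a::euclidean_space measure \<Rightarrow> bool" where
  "borel_measure \<mu> \<longleftrightarrow> sets \<mu> = sets borel"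

text \<open>The convolution is only applied to non-negative \<open>g\<close>; \<^const>\<open>ennreal\<close> truncates negative values.\<close>
definition measure_conv :: "'a::euclidean_space measure \<Rightarrow> ('a \<Rightarrow> real) \<Rightarrow> 'a \<Rightarrow> ennreal" where
  "measure_conv \<mu> g x = (\<integral>\<^sup>+ t. ennreal (g (x - t)) \<partial>\<mu>)"

definition covering_measure ::
    "'a::euclidean_space measure \<Rightarrow> ('a \<Rightarrow> real) \<Rightarrow> ('a \<Rightarrow> real) \<Rightarrow> bool" where
  "covering_measure \<mu> f g \<longleftrightarrow>
     borel_measure \<mu> \<and> (\<forall>x. ennreal (f x) \<le> measure_conv \<mu> g x)"

definition N1 :: "('a::euclidean_space \<Rightarrow> real) \<Rightarrow> ('a \<Rightarrow> real) \<Rightarrow> ennreal" where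
  "N1 f g = Inf {emeasure \<mu> UNIV | \<mu>. covering_measure \<mu> f g}"

text \<open>
  The measures competing in the supremum are required to be sigma-finite; this includes every
  Borel measure that is finite on compact sets. Some such convention is needed: even the weak
  duality \<open>M1 f (\<lambda>x. g (- x)) \<le> N1 f g\<close> is an exchange of integrals that fails for arbitrary
  Borel measures. For example, let \<open>f\<close> and \<open>g\<close> be the indicators of \<open>[0,1]\<close> and of a compact
  nowhere dense set \<open>K\<close> of positive Lebesgue measure, and let \<open>\<rho>\<close> be \<open>0\<close> on the Borel sets that
  are covered by countably many translates of \<open>K\<close> and \<open>\<infinity>\<close> on the others. Then the convolution
  of \<open>\<rho>\<close> with \<open>\<lambda>x. g (- x)\<close> vanishes and \<open>\<integral> f d\<rho> = \<infinity>\<close> by Baire's theorem, while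
  \<open>N1 f g < \<infinity>\<close>, as a multiple of Lebesgue measure on a bounded interval covers \<open>f\<close> by \<open>g\<close>.
  The infimum in \<open>N1\<close> needs no such restriction.
\<close>
definition M1 :: "('a::euclidean_space \<Rightarrow> real) \<Rightarrow> ('a \<Rightarrow> real) \<Rightarrow> ennreal" where
  "M1 f g = Sup {(\<integral>\<^sup>+ x. ennreal (f x) \<partial>\<rho>) | \<rho>.
     borel_measure \<rho> \<and> sigma_finite_measure \<rho> \<and> (\<forall>x. measure_conv \<rho> g x \<le> 1)}"

end

theory Submission
  imports Defs "HOL-Probability.Helly_Selection" "HOL-Probability.Probability_Mass_Function"
begin

text \<open>
  Fix a mass \<open>m\<close>, and let the points \<open>(X i, f (X i))\<close> be dense in the graph of \<open>f\<close>. For each \<open>j\<close> consider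
  the finite problem of covering \<open>f\<close> at \<open>X 0, \<dots>, X j\<close> by \<open>G j\<close> with mass \<open>m\<close>. If these problems are
  all solvable up to arbitrarily small errors, a vague limit \<open>\<mu>\<close> of almost solutions satisfies
  \<open>\<mu> * G k \<ge> f\<close> at all \<open>X i\<close>, hence everywhere by continuity of \<open>\<mu> * G k\<close>, and \<open>\<mu> * g \<ge> f\<close> as
  \<open>k \<rightarrow> \<infinity>\<close>. Otherwise some finite problem is infeasible and a separation argument gives a finitely
  supported \<open>\<rho>\<close> with \<open>\<integral> f d\<rho> > m\<close> that is dual feasible for \<open>G j\<close>, and so for the smaller \<open>g\<close>. Together
  with weak duality, taking \<open>m = N1 f g\<close> and \<open>m < N1 f g\<close> gives all three claims.
\<close>

section \<open>A space-filling curve\<close>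

text \<open>Greedy digits: \<open>r k\<close> is the remainder after \<open>k\<close> digits,
  multiplied by \<open>2 ^ k\<close>. Doubling and subtracting the digit keeps it in the unit
  interval, so the error \<open>r n / 2 ^ n\<close> tends to 0. The value 1 is fixed by the
  recursion and yields only ones.\<close>

lemma binary_expansion_exists:
  fixes y :: real
  assumes "y \<in> {0..1}"
  obtains d :: "nat \<Rightarrow> bool" where "(\<lambda>k. of_bool (d k) / 2 ^ Suc k) sums y"
proof -
  define r where "r = rec_nat y (\<lambda>_ r. 2 * r - of_bool (1 / 2 \<le> r))"
  have r_0: "r 0 = y" and r_Suc: "r (Suc k) = 2 * r k - of_bool (1 / 2 \<le> r k)" for k
    by (simp_all add: r_def)
  have r: "r k \<in> {0..1}" for k
    by (induction k) (use assms in \<open>auto simp: r_0 r_Suc\<close>)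
  have "(\<Sum>k<n. of_bool (1 / 2 \<le> r k) / 2 ^ Suc k) = y - r n / 2 ^ n" for n
    by (induction n) (auto simp: r_0 r_Suc field_simps)
  moreover have "(\<lambda>n. y - r n / 2 ^ n) \<longlonglongrightarrow> y - 0"
  proof (intro tendsto_diff tendsto_const)
    have "(\<lambda>n. (1 / 2) ^ n :: real) \<longlonglongrightarrow> 0"
      by (rule LIMSEQ_power_zero) simp
    then show "(\<lambda>n. r n / 2 ^ n) \<longlonglongrightarrow> 0"
      by (rule Lim_null_comparison[rotated])
         (use r in \<open>auto simp: power_one_over divide_right_mono intro!: always_eventually\<close>)
  qed
  ultimately have "(\<lambda>k. of_bool (1 / 2 \<le> r k) / 2 ^ Suc k) sums y"
    by (simp add: sums_def)
  then show thesis by (rule that)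
qed

text \<open>Schoenberg's curve, with a clamped cosine for his piecewise linear wave and the pairing function
  for his interleaving of digits: \<open>3 ^ j * t\<close> reads off the \<open>j\<close>-th ternary digit of \<open>t\<close>.\<close>

definition schoenberg_wave :: "real \<Rightarrow> real" where
  "schoenberg_wave t = max 0 (min 1 (1 / 2 - cos (pi * t)))"

lemma schoenberg_wave_range: "schoenberg_wave t \<in> {0..1}"
  by (auto simp: schoenberg_wave_def)

lemma continuous_on_schoenberg_wave [continuous_intros]:
  fixes f :: "real \<Rightarrow> real"
  shows "continuous_on S f \<Longrightarrow> continuous_on S (\<lambda>t. schoenberg_wave (f t))"
  unfolding schoenberg_wave_def by (intro continuous_intros)

lemma schoenberg_wave_periodic: "schoenberg_wave (2 * of_nat n + t) = schoenberg_wave t"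
proof -
  have "cos (pi * (2 * of_nat n + t)) = cos (pi * t + 2 * of_nat n * pi)"
    by (simp add: algebra_simps)
  also have "\<dots> = cos (pi * t)"
    by (simp add: cos_add)
  finally show ?thesis by (simp add: schoenberg_wave_def)
qed

text \<open>The cosine is at least 1/2 here and at most -1/2 on the mirrored interval of the next
  lemma. The clamp turns both bounds into exact plateaus.\<close>

lemma schoenberg_wave_eq_0:
  assumes "0 \<le> t" "t \<le> 1 / 3"
  shows "schoenberg_wave t = 0"
proof -
  have "cos (pi / 3) \<le> cos (pi * t)"
    using assms by (subst cos_mono_le_eq) (auto simp: field_simps)
  then show ?thesis by (simp add: schoenberg_wave_def cos_60)
qed

lemma schoenberg_wave_eq_1:
  assumes "2 / 3 \<le> t" "t \<le> 1"
  shows "schoenberg_wave t = 1"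
proof -
  have "cos (pi * t) = - cos (pi * (1 - t))"
    by (simp add: right_diff_distrib cos_diff)
  moreover have "cos (pi / 3) \<le> cos (pi * (1 - t))"
    using assms by (subst cos_mono_le_eq) (auto simp: field_simps)
  ultimately show ?thesis by (simp add: schoenberg_wave_def cos_60)
qed

text \<open>Take the number whose ternary digits are 0 or 2 according to \<open>a\<close>. Its tail
  \<open>T k\<close> after \<open>k\<close> digits, rescaled, lies in the lower or upper third of
  the unit interval according to \<open>a k\<close>, and there the wave is constant.\<close>

lemma schoenberg_wave_digits:
  fixes a :: "nat \<Rightarrow> bool"
  obtains t where "t \<in> {0..1}" "\<And>j. schoenberg_wave (3 ^ j * t) = of_bool (a j)"
proof -
  define T where "T k = (\<Sum>j. 2 * of_bool (a (k + j)) / 3 ^ Suc j :: real)" for k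
  have geo: "(\<lambda>j. 2 / 3 ^ Suc j :: real) sums 1"
    using sums_mult[OF geometric_sums[of "1 / 3 :: real"], of "2 / 3"]
    by (simp add: power_one_over field_simps)
  have summ: "summable (\<lambda>j. 2 * of_bool (a (k + j)) / 3 ^ Suc j :: real)" for k
    by (rule summable_comparison_test'[OF sums_summable[OF geo], of 0]) (auto simp: divide_simps)
  have T_le: "T k \<le> 1" for k
    unfolding T_def sums_unique[OF geo]
    by (rule suminf_le[OF _ summ sums_summable[OF geo]]) (auto simp: divide_simps)
  have T_ge: "0 \<le> T k" for k
    unfolding T_def by (rule suminf_nonneg[OF summ]) auto
  have T_rec: "3 * T k = 2 * of_bool (a k) + T (Suc k)" for k
  proof -
    have "T k = 2 * of_bool (a k) / 3 + (\<Sum>j. 2 * of_bool (a (k + Suc j)) / 3 ^ Suc (Suc j))"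
      unfolding T_def using suminf_split_head[OF summ, of k] by simp
    also have "(\<Sum>j. 2 * of_bool (a (k + Suc j)) / 3 ^ Suc (Suc j) :: real) = T (Suc k) / 3"
      unfolding T_def using suminf_divide[OF summ, of "Suc k" 3] by (simp add: field_simps)
    finally show ?thesis by simp
  qed
  \<comment> \<open>The digits shifted in front of the ternary point form an even integer, as each
    of them is 0 or 2; the period 2 of the wave removes it.\<close>
  have "\<exists>n::nat. 3 ^ j * T 0 = 2 * of_nat n + T j" for j
  proof (induction j)
    case 0
    then show ?case by (intro exI[of _ 0]) simp
  next
    case (Suc j)
    then obtain n :: nat where "3 ^ j * T 0 = 2 * of_nat n + T j" by blast
    then have "3 ^ Suc j * T 0 = 2 * of_nat (3 * n + of_bool (a j)) + T (Suc j)"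
      using T_rec[of j] by simp
    then show ?case by blast
  qed
  then have "schoenberg_wave (3 ^ j * T 0) = schoenberg_wave (T j)" for j
    using schoenberg_wave_periodic by metis
  moreover have "schoenberg_wave (T j) = of_bool (a j)" for j
    using T_rec[of j] T_ge[of "Suc j"] T_le[of "Suc j"] T_ge[of j] T_le[of j]
    by (cases "a j") (auto intro: schoenberg_wave_eq_0 schoenberg_wave_eq_1)
  ultimately show thesis
    using that[of "T 0"] T_ge T_le by simp
qed

definition schoenberg_coord :: "nat \<Rightarrow> real \<Rightarrow> real" where
  "schoenberg_coord i t = (\<Sum>k. schoenberg_wave (3 ^ prod_encode (i, k) * t) / 2 ^ Suc k)"

lemma continuous_on_schoenberg_coord: "continuous_on S (schoenberg_coord i)"
proof -
  have "summable (\<lambda>k. 1 / 2 ^ Suc k :: real)"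
    using sums_summable[OF power_half_series] by (simp add: power_one_over)
  then have "uniform_limit UNIV
      (\<lambda>n t. \<Sum>k<n. schoenberg_wave (3 ^ prod_encode (i, k) * t) / 2 ^ Suc k)
      (schoenberg_coord i) sequentially"
    unfolding schoenberg_coord_def
    by (rule Weierstrass_m_test[rotated])
       (use schoenberg_wave_range in \<open>auto simp: divide_simps\<close>)
  moreover have "continuous_on UNIV
      (\<lambda>t. \<Sum>k<n. schoenberg_wave (3 ^ prod_encode (i, k) * t) / 2 ^ Suc k)" for n
    by (intro continuous_intros) auto
  ultimately have "continuous_on UNIV (schoenberg_coord i)"
    by (intro uniform_limit_theorem[where F = sequentially]) auto
  then show ?thesis
    by (rule continuous_on_subset) simp
qed

text \<open>The binary digits of all \<open>y i\<close> are merged into one sequence, the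
  \<open>k\<close>-th digit of \<open>y i\<close> at position \<open>prod_encode (i, k)\<close>. One
  parameter displays this sequence, so it meets all coordinates at once.\<close>

lemma schoenberg_coord_surj:
  assumes "\<And>i. y i \<in> {0..1}"
  obtains t where "t \<in> {0..1}" "\<And>i. schoenberg_coord i t = y i"
proof -
  have "\<exists>d :: nat \<Rightarrow> bool. (\<lambda>k. of_bool (d k) / 2 ^ Suc k) sums y i" for i
    using binary_expansion_exists[OF assms[of i]] by metis
  then obtain d :: "nat \<Rightarrow> nat \<Rightarrow> bool"
    where d: "\<And>i. (\<lambda>k. of_bool (d i k) / 2 ^ Suc k) sums y i"
    by metis
  obtain t where "t \<in> {0..1}"
    and "\<And>j. schoenberg_wave (3 ^ j * t) = of_bool (case_prod d (prod_decode j))"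
    using schoenberg_wave_digits[of "\<lambda>j. case_prod d (prod_decode j)"] by metis
  moreover from this have "schoenberg_coord i t = y i" for i
    using sums_unique[OF d[of i]] by (simp add: schoenberg_coord_def)
  ultimately show thesis using that by blast
qed

text \<open>The coordinates, rescaled from [0, 1] to [-1, 1], fill a cube, which contains the unit
  ball.\<close>

lemma space_filling_curve_exists:
  obtains c :: "real \<Rightarrow> 'a::euclidean_space"
  where "continuous_on UNIV c" "cball 0 1 \<subseteq> c ` {0..1}"
proof
  define ix :: "'a \<Rightarrow> nat" where "ix = to_nat_on Basis"
  define c :: "real \<Rightarrow> 'a"
    where "c t = (\<Sum>b\<in>Basis. (2 * schoenberg_coord (ix b) t - 1) *\<^sub>R b)" for t
  show "continuous_on UNIV c"
    unfolding c_def by (intro continuous_intros continuous_on_schoenberg_coord)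
  show "cball 0 1 \<subseteq> c ` {0..1}"
  proof
    fix z :: 'a
    assume "z \<in> cball 0 1"
    then have le: "\<bar>z \<bullet> b\<bar> \<le> 1" if "b \<in> Basis" for b
      using Basis_le_norm[OF that, of z] by simp
    define y where "y i = (z \<bullet> from_nat_into Basis i + 1) / 2" for i
    \<comment> \<open>\<open>from_nat_into\<close> returns a basis vector even at indices beyond the
      dimension, so the bound holds for every \<open>i\<close>.\<close>
    have "y i \<in> {0..1}" for i
      using le[OF from_nat_into, of i] by (simp add: y_def abs_le_iff)
    then obtain t where t: "t \<in> {0..1}" "\<And>i. schoenberg_coord i t = y i"
      using schoenberg_coord_surj by metis
    have "c t = (\<Sum>b\<in>Basis. (z \<bullet> b) *\<^sub>R b)"
      unfolding c_def by (intro sum.cong) (auto simp: t y_def ix_def countable_finite field_simps)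
    then show "z \<in> c ` {0..1}"
      using t(1) by (auto simp: euclidean_representation)
  qed
qed

section \<open>Vague compactness\<close>

lemma C0_functions_iff:
  "h \<in> C0_functions \<longleftrightarrow>
     continuous_on UNIV h \<and> (\<forall>e>0. \<exists>R. \<forall>x. R \<le> norm x \<longrightarrow> \<bar>h x\<bar> < e)"
  by (simp add: C0_functions_def tendsto_iff eventually_at_infinity dist_real_def)

lemma C0_functions_continuous: "h \<in> C0_functions \<Longrightarrow> continuous_on S h"
  unfolding C0_functions_def using continuous_on_subset by blast

lemma C0_functions_measurable:
  "h \<in> C0_functions \<Longrightarrow> h \<in> borel_measurable borel"
  by (intro borel_measurable_continuous_onI C0_functions_continuous)

lemma C0_functions_bounded:
  assumes "h \<in> C0_functions"
  obtains B where "0 < B" "\<And>x. \<bar>h x\<bar> \<le> B"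
proof -
  obtain R where R: "\<And>x. R \<le> norm x \<Longrightarrow> \<bar>h x\<bar> < 1"
    using assms unfolding C0_functions_iff by (meson zero_less_one)
  have "bounded (h ` cball 0 R)"
    using assms by (intro compact_imp_bounded compact_continuous_image C0_functions_continuous) auto
  then obtain B where "\<forall>y\<in>h ` cball 0 R. norm y \<le> B"
    unfolding bounded_iff by blast
  then have B: "\<bar>h x\<bar> \<le> B" if "norm x \<le> R" for x
    using that by auto
  have "\<bar>h x\<bar> \<le> max 1 B" for x
    using R[of x] B[of x] by (cases "norm x \<le> R") auto
  then show thesis by (intro that[of "max 1 B"]) auto
qed

text \<open>Makes the convolution with \<open>h\<close> at a fixed \<open>x\<close> the integral of
  a test function for vague convergence.\<close>

lemma C0_functions_reflect_shift:
  assumes "h \<in> C0_functions"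
  shows "(\<lambda>y. h (x - y)) \<in> C0_functions"
  unfolding C0_functions_iff
proof (intro conjI allI impI)
  show "continuous_on UNIV (\<lambda>y. h (x - y))"
    using C0_functions_continuous[OF assms, of UNIV]
    by (rule continuous_on_compose2) (auto intro!: continuous_intros)
  fix e :: real
  assume "0 < e"
  then obtain R where R: "\<And>y. R \<le> norm y \<Longrightarrow> \<bar>h y\<bar> < e"
    using assms unfolding C0_functions_iff by blast
  have "\<bar>h (x - y)\<bar> < e" if "R + norm x \<le> norm y" for y
    using that norm_triangle_ineq2[of y x] by (intro R) (simp add: norm_minus_commute)
  then show "\<exists>R. \<forall>y. R \<le> norm y \<longrightarrow> \<bar>h (x - y)\<bar> < e" by blast
qed

text \<open>On the open unit ball this is a homeomorphism onto the whole space, with inverse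
  \<open>x /\<^sub>R (1 + norm x)\<close>; the boundary sphere corresponds to infinity.\<close>

definition ball_stretch :: "'a::real_normed_vector \<Rightarrow> 'a" where
  "ball_stretch z = z /\<^sub>R (1 - norm z)"

lemma ball_stretch_surj:
  obtains z where "norm z < 1" "ball_stretch z = x"
proof
  have pos: "0 < 1 + norm x"
    by (simp add: add_pos_nonneg)
  define z where "z = x /\<^sub>R (1 + norm x)"
  have norm_z: "norm z = norm x / (1 + norm x)"
    using pos by (simp add: z_def divide_inverse)
  show "norm z < 1"
    using pos by (simp add: norm_z)
  have "1 - norm z = inverse (1 + norm x)"
    using pos by (simp add: norm_z field_simps)
  then show "ball_stretch z = x"
    using pos by (simp add: ball_stretch_def z_def)
qed

lemma continuous_on_ball_stretch: "continuous_on (ball 0 1) ball_stretch"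
  unfolding ball_stretch_def by (intro continuous_intros) auto

text \<open>As \<open>w\<close> approaches the sphere from inside, \<open>ball_stretch w\<close>
  leaves every ball, so \<open>h\<close> tends to 0 there and extension by 0 is continuous.\<close>

lemma continuous_on_C0_ball_stretch:
  assumes "h \<in> C0_functions"
  shows "continuous_on UNIV (\<lambda>z. if norm z < 1 then h (ball_stretch z) else 0)"
    (is "continuous_on UNIV ?H")
proof (rule continuous_at_imp_continuous_on, rule ballI)
  fix z :: 'a
  show "isCont ?H z"
  proof (cases "norm z < 1")
    case True
    have "continuous_on (ball 0 1) (\<lambda>z. h (ball_stretch z))"
      using C0_functions_continuous[OF assms, of UNIV] continuous_on_ball_stretch
      by (rule continuous_on_compose2) auto
    then have "continuous_on (ball 0 1) ?H"
      by (rule continuous_on_eq) auto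
    then show ?thesis
      using True by (simp add: continuous_on_eq_continuous_at)
  next
    case False
    have "(?H \<longlongrightarrow> 0) (at z)"
    proof (rule tendstoI)
      fix e :: real
      assume e: "0 < e"
      then obtain R where R: "\<And>y. R \<le> norm y \<Longrightarrow> \<bar>h y\<bar> < e"
        using assms unfolding C0_functions_iff by blast
      \<comment> \<open>\<open>R' / (1 + R')\<close> is the radius that \<open>ball_stretch\<close>
        maps to \<open>R'\<close>; the maximum with 0 keeps the denominator positive.\<close>
      define R' where "R' = max R 0"
      have "0 \<le> R'" by (simp add: R'_def)
      then have "R' / (1 + R') < 1" by simp
      then have "\<forall>\<^sub>F w in at z. R' / (1 + R') < norm w"
        using False by (intro order_tendstoD(1)[OF tendsto_norm[OF tendsto_ident_at]]) auto
      then show "\<forall>\<^sub>F w in at z. dist (?H w) 0 < e"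
      proof eventually_elim
        case (elim w)
        show ?case
        proof (cases "norm w < 1")
          case True
          have "R' \<le> norm w / (1 - norm w)"
            using elim True \<open>0 \<le> R'\<close> by (simp add: field_simps)
          then have "R \<le> norm (ball_stretch w)"
            using True by (simp add: ball_stretch_def R'_def divide_inverse mult.commute)
          then show ?thesis using R True by simp
        qed (use e in simp)
      qed
    qed
    then show ?thesis using False by (simp add: isCont_def)
  qed
qed

text \<open>Lifting the measures along a space-filling curve onto the one-point compactification reduces
  the compactness to Helly's theorem on the real line.\<close>

lemma pmf_vague_compactness:
  fixes p :: "nat \<Rightarrow> 'a::euclidean_space pmf"
  obtains r \<mu> where "strict_mono r" "sets \<mu> = sets borel" "emeasure \<mu> UNIV \<le> 1"
    "\<And>h. h \<in> C0_functions \<Longrightarrow>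
       (\<lambda>j. measure_pmf.expectation (p (r j)) h) \<longlonglongrightarrow> (\<integral>x. h x \<partial>\<mu>)"
proof -
  obtain c :: "real \<Rightarrow> 'a" where c: "continuous_on UNIV c" "cball 0 1 \<subseteq> c ` {0..1}"
    using space_filling_curve_exists by blast
  have "\<exists>t. t \<in> {0..1} \<and> norm (c t) < 1 \<and> ball_stretch (c t) = x" for x
  proof -
    obtain z where "norm z < 1" "ball_stretch z = x"
      by (rule ball_stretch_surj)
    moreover from this c(2) have "z \<in> c ` {0..1}" by auto
    ultimately show ?thesis by blast
  qed
  then obtain s where s: "\<And>x. s x \<in> {0..1}" "\<And>x. norm (c (s x)) < 1"
    "\<And>x. ball_stretch (c (s x)) = x"
    by metis
  \<comment> \<open>\<open>s\<close> is an arbitrary choice function; it is measurable because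
    \<open>measure_pmf\<close> carries the sigma-algebra of all subsets.\<close>
  define \<nu> where "\<nu> j = distr (measure_pmf (p j)) borel s" for j
  have \<nu>: "real_distribution (\<nu> j)" for j
    unfolding \<nu>_def by (rule prob_space.real_distribution_distr[OF prob_space_measure_pmf]) simp
  have "tight \<nu>"
    unfolding tight_def
  proof (intro conjI allI impI)
    fix e :: real
    assume "0 < e"
    \<comment> \<open>Tightness is phrased with intervals open on the left, so the left end is -1 in
      order to include mass at 0.\<close>
    have "measure (\<nu> j) {- 1<..1} = 1" for j
    proof -
      have "s -` {- 1<..1} = UNIV" using s(1) by (auto simp: less_le_trans[of "- 1 :: real" 0])
      then show ?thesis
        by (simp add: \<nu>_def measure_distr measure_pmf.prob_space[simplified])
    qed
    then show "\<exists>a b. a < b \<and> (\<forall>j. 1 - e < measure (\<nu> j) {a<..b})"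
      using \<open>0 < e\<close> by (intro exI[of _ "- 1"] exI[of _ 1]) simp
  qed (rule \<nu>)
  from tight_imp_convergent_subsubsequence[OF this strict_mono_id]
  obtain r M where r: "strict_mono r" and M: "real_distribution M"
    and conv: "weak_conv_m (\<nu> \<circ> r) M"
    by auto
  interpret M: real_distribution M by fact
  define U where "U = {t. norm (c t) < 1}"
  have "open U"
    unfolding U_def using c(1) by (intro open_Collect_less continuous_intros)
  then have U [measurable]: "U \<in> sets borel" by simp
  define \<pi> where "\<pi> t = (if t \<in> U then ball_stretch (c t) else 0)" for t
  have [measurable]: "\<pi> \<in> borel_measurable borel"
  proof -
    have "continuous_on U (\<lambda>t. ball_stretch (c t))"
      using continuous_on_ball_stretch continuous_on_subset[OF c(1), of U]
      by (rule continuous_on_compose2) (auto simp: U_def)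
    then show ?thesis
      unfolding \<pi>_def using \<open>open U\<close> by (intro borel_measurable_continuous_on_if) auto
  qed
  \<comment> \<open>The mass of \<open>M\<close> outside \<open>U\<close> is mass that has escaped
    to infinity. It is discarded, so only total mass at most 1 remains.\<close>
  define \<mu> where "\<mu> = distr (density M (\<lambda>t. ennreal (indicator U t))) borel \<pi>"
  show thesis
  proof (rule that[OF r, of \<mu>])
    show "sets \<mu> = sets borel" by (simp add: \<mu>_def)
    have "emeasure \<mu> UNIV = (\<integral>\<^sup>+ t. indicator U t \<partial>M)"
      by (simp add: \<mu>_def emeasure_distr emeasure_density space_density ennreal_indicator)
    also have "\<dots> \<le> 1"
      using M.emeasure_le_1 by simp
    finally show "emeasure \<mu> UNIV \<le> 1" .
    fix h :: "'a \<Rightarrow> real"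
    assume h: "h \<in> C0_functions"
    note [measurable] = C0_functions_measurable[OF h]
    obtain B where B: "0 < B" "\<And>x. \<bar>h x\<bar> \<le> B"
      using C0_functions_bounded[OF h] by metis
    \<comment> \<open>\<open>H\<close> is \<open>h\<close> transported to the line: it is continuous
      and bounded, agrees with \<open>h\<close> along \<open>s\<close>, and vanishes off
      \<open>U\<close>, so the discarded mass does not affect its integral.\<close>
    define H where "H t = (if norm (c t) < 1 then h (ball_stretch (c t)) else 0)" for t
    have H: "continuous_on UNIV H"
      unfolding H_def
      by (rule continuous_on_compose2[OF continuous_on_C0_ball_stretch[OF h] c(1)]) simp
    have "(\<lambda>j. integral\<^sup>L ((\<nu> \<circ> r) j) H) \<longlonglongrightarrow> integral\<^sup>L M H"
    proof (rule weak_conv_imp_integral_bdd_continuous_conv[OF _ M conv])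
      show "real_distribution ((\<nu> \<circ> r) j)" for j by (simp add: \<nu>)
      show "isCont H t" for t using H by (simp add: continuous_on_eq_continuous_at)
      show "norm (H t) \<le> B" for t using B by (simp add: H_def)
    qed
    moreover have "integral\<^sup>L (\<nu> j) H = measure_pmf.expectation (p j) h" for j
      using borel_measurable_continuous_onI[OF H] s unfolding \<nu>_def
      by (subst integral_distr) (auto simp: H_def)
    moreover have "integral\<^sup>L M H = integral\<^sup>L \<mu> h"
    proof -
      have "integral\<^sup>L \<mu> h = (\<integral>t. h (\<pi> t) \<partial>density M (\<lambda>t. ennreal (indicator U t)))"
        unfolding \<mu>_def by (rule integral_distr) simp_all
      also have "\<dots> = (\<integral>t. indicator U t *\<^sub>R h (\<pi> t) \<partial>M)"
        by (rule integral_density) simp_all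
      also have "(\<lambda>t. indicator U t *\<^sub>R h (\<pi> t)) = H"
        by (auto simp: H_def U_def \<pi>_def)
      finally show ?thesis ..
    qed
    ultimately show "(\<lambda>j. measure_pmf.expectation (p (r j)) h) \<longlonglongrightarrow> integral\<^sup>L \<mu> h"
      by simp
  qed
qed

section \<open>Duality for finitely many points\<close>

text \<open>The multipliers \<open>\<rho>\<close> are the positive parts of \<open>f - v\<close> for an almost minimizer \<open>v \<in> S\<close> of the
  squared distance to the orthant above \<open>f\<close>; moving from \<open>v\<close> towards \<open>w\<close> cannot decrease it much.\<close>

lemma separation_from_orthant:
  fixes S :: "('i \<Rightarrow> real) set" and f :: "'i \<Rightarrow> real"
  assumes "finite I" and "S \<noteq> {}"
    and convex: "\<And>v w \<epsilon>. v \<in> S \<Longrightarrow> w \<in> S \<Longrightarrow> 0 < \<epsilon> \<Longrightarrow> \<epsilon> \<le> 1 \<Longrightarrow> (\<lambda>i. (1 - \<epsilon>) * v i + \<epsilon> * w i) \<in> S"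
    and bounds: "\<And>v i. v \<in> S \<Longrightarrow> i \<in> I \<Longrightarrow> 0 \<le> v i \<and> v i \<le> B"
    and "0 < \<delta>" and far: "\<And>v. v \<in> S \<Longrightarrow> \<delta> \<le> (\<Sum>i\<in>I. (max 0 (f i - v i))\<^sup>2)"
  obtains \<rho> b where "\<And>i. 0 \<le> \<rho> i" "0 < b" "b < (\<Sum>i\<in>I. \<rho> i * f i)"
    "\<And>w. w \<in> S \<Longrightarrow> (\<Sum>i\<in>I. \<rho> i * w i) \<le> b"
proof -
  define \<Phi> where "\<Phi> v = (\<Sum>i\<in>I. (max 0 (f i - v i))\<^sup>2)" for v
  define D where "D = Inf (\<Phi> ` S)"
  have bdd: "bdd_below (\<Phi> ` S)"
    by (rule bdd_belowI[of _ 0]) (auto simp: \<Phi>_def intro: sum_nonneg)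
  have "0 < D"
  proof -
    have "\<delta> \<le> D"
      unfolding D_def using \<open>S \<noteq> {}\<close> far by (intro cINF_greatest) (auto simp: \<Phi>_def)
    then show ?thesis using \<open>0 < \<delta>\<close> by simp
  qed
  have D_le: "D \<le> \<Phi> v" if "v \<in> S" for v
    unfolding D_def using bdd that by (intro cINF_lower)
  define K where "K = of_nat (card I) * B\<^sup>2"
  have "0 \<le> K" by (simp add: K_def)
  \<comment> \<open>\<open>K\<close> bounds the squared distance of two points of \<open>S\<close>.
    This step length makes the quadratic term at most \<open>\<epsilon> * D / 2\<close>, the same as
    the tolerance allowed for \<open>v\<close>.\<close>
  define \<epsilon> where "\<epsilon> = min 1 (D / (2 * (K + 1)))"
  have \<epsilon>: "0 < \<epsilon>" "\<epsilon> \<le> 1"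
    using \<open>0 < D\<close> \<open>0 \<le> K\<close> by (auto simp: \<epsilon>_def)
  have "\<epsilon> * K \<le> D / (2 * (K + 1)) * (K + 1)"
    using \<epsilon> \<open>0 \<le> K\<close> \<open>0 < D\<close> by (intro mult_mono) (auto simp: \<epsilon>_def)
  also have "\<dots> = D / 2"
    using \<open>0 \<le> K\<close> by (simp add: field_simps)
  finally have \<epsilon>K: "\<epsilon> * K \<le> D / 2" .
  have "Inf (\<Phi> ` S) < D + \<epsilon> * D / 2"
    using \<epsilon>(1) \<open>0 < D\<close> by (simp add: D_def[symmetric])
  then obtain v where v: "v \<in> S" and v_min: "\<Phi> v < D + \<epsilon> * D / 2"
    using cInf_lessD[of "\<Phi> ` S"] \<open>S \<noteq> {}\<close> by auto
  define \<rho> where "\<rho> i = max 0 (f i - v i)" for i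
  \<comment> \<open>\<open>max 0 a * a\<close> equals the square of \<open>max 0 a\<close>, so
    \<open>\<Phi> v\<close> is the gap between \<open>f\<close> and \<open>v\<close> in direction
    \<open>\<rho>\<close>.\<close>
  have \<rho>v: "(\<Sum>i\<in>I. \<rho> i * v i) = (\<Sum>i\<in>I. \<rho> i * f i) - \<Phi> v"
    unfolding \<Phi>_def sum_subtractf[symmetric]
    by (intro sum.cong) (auto simp: \<rho>_def max_def power2_eq_square algebra_simps)
  have \<rho>w: "(\<Sum>i\<in>I. \<rho> i * w i) \<le> (\<Sum>i\<in>I. \<rho> i * v i) + D / 2" if "w \<in> S" for w
  proof -
    let ?A = "\<Sum>i\<in>I. \<rho> i * (w i - v i)"
    have "D \<le> \<Phi> (\<lambda>i. (1 - \<epsilon>) * v i + \<epsilon> * w i)"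
      using v that \<epsilon> by (intro D_le convex)
    also have "\<dots> \<le> (\<Sum>i\<in>I. (\<rho> i - \<epsilon> * (w i - v i))\<^sup>2)"
      unfolding \<Phi>_def
    proof (rule sum_mono)
      fix i
      \<comment> \<open>As \<open>f i - v i \<le> \<rho> i\<close>, putting \<open>\<rho> i\<close>
        in its place only enlarges the positive part, and what remains is a quadratic polynomial in
        \<open>\<epsilon>\<close>.\<close>
      have "\<bar>max 0 (f i - ((1 - \<epsilon>) * v i + \<epsilon> * w i))\<bar> \<le> \<bar>\<rho> i - \<epsilon> * (w i - v i)\<bar>"
        by (auto simp: \<rho>_def algebra_simps max_def)
      then show "(max 0 (f i - ((1 - \<epsilon>) * v i + \<epsilon> * w i)))\<^sup>2 \<le> (\<rho> i - \<epsilon> * (w i - v i))\<^sup>2"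
        by (rule abs_le_square_iff[THEN iffD1])
    qed
    also have "\<dots> = (\<Sum>i\<in>I. (\<rho> i)\<^sup>2) - 2 * \<epsilon> * ?A + \<epsilon>\<^sup>2 * (\<Sum>i\<in>I. (w i - v i)\<^sup>2)"
    proof -
      have "(a - \<epsilon> * d)\<^sup>2 = a\<^sup>2 - 2 * \<epsilon> * (a * d) + \<epsilon>\<^sup>2 * d\<^sup>2" for a d :: real
        by (simp add: power2_eq_square algebra_simps)
      then show ?thesis
        by (simp only: sum.distrib sum_subtractf sum_distrib_left)
    qed
    also have "(\<Sum>i\<in>I. (\<rho> i)\<^sup>2) = \<Phi> v"
      by (simp add: \<Phi>_def \<rho>_def)
    also have "(\<Sum>i\<in>I. (w i - v i)\<^sup>2) \<le> K"
    proof -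
      have "(w i - v i)\<^sup>2 \<le> B\<^sup>2" if "i \<in> I" for i
        using bounds[OF v that] bounds[OF \<open>w \<in> S\<close> that]
        by (intro abs_le_square_iff[THEN iffD1]) auto
      then show ?thesis
        using sum_bounded_above[of I "\<lambda>i. (w i - v i)\<^sup>2" "B\<^sup>2"] by (simp add: K_def)
    qed
    finally have "D \<le> \<Phi> v - 2 * \<epsilon> * ?A + \<epsilon>\<^sup>2 * K"
      by (simp add: mult_left_mono)
    then have "2 * \<epsilon> * ?A \<le> \<epsilon> * D / 2 + \<epsilon> * (\<epsilon> * K)"
      using v_min by (simp add: power2_eq_square)
    also have "\<dots> \<le> \<epsilon> * D / 2 + \<epsilon> * (D / 2)"
      using \<epsilon> \<epsilon>K by (intro add_left_mono mult_left_mono) auto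
    finally have "\<epsilon> * (2 * ?A) \<le> \<epsilon> * D"
      by (simp add: mult_ac)
    then have "2 * ?A \<le> D"
      using \<epsilon> by simp
    then show ?thesis
      by (simp add: right_diff_distrib sum_subtractf)
  qed
  show thesis
  \<comment> \<open>Paired with \<open>\<rho>\<close>, \<open>f\<close> exceeds \<open>v\<close> by
    at least \<open>D\<close> and each \<open>w\<close> exceeds \<open>v\<close> by at most
    \<open>D / 2\<close>; \<open>b\<close> is placed between.\<close>
  proof (rule that[of \<rho> "(\<Sum>i\<in>I. \<rho> i * f i) - D / 2"])
    show "0 \<le> \<rho> i" for i by (simp add: \<rho>_def)
    have "0 \<le> (\<Sum>i\<in>I. \<rho> i * v i)"
      using bounds[OF v] by (intro sum_nonneg mult_nonneg_nonneg) (auto simp: \<rho>_def)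
    then show "0 < (\<Sum>i\<in>I. \<rho> i * f i) - D / 2"
      using \<rho>v D_le[OF v] \<open>0 < D\<close> by simp
    show "(\<Sum>i\<in>I. \<rho> i * f i) - D / 2 < (\<Sum>i\<in>I. \<rho> i * f i)"
      using \<open>0 < D\<close> by simp
    show "(\<Sum>i\<in>I. \<rho> i * w i) \<le> (\<Sum>i\<in>I. \<rho> i * f i) - D / 2" if "w \<in> S" for w
      using \<rho>w[OF that] \<rho>v D_le[OF v] by simp
  qed
qed

text \<open>The graph is separable as a subset of a product of Euclidean spaces. Density in the
  graph, rather than in the domain, also approximates the values of a discontinuous
  \<open>f\<close>.\<close>

lemma dense_graph_sequence:
  fixes f :: "'a::euclidean_space \<Rightarrow> real"
  obtains X :: "nat \<Rightarrow> 'a"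
  where "\<And>x. \<exists>r. (\<lambda>j. X (r j)) \<longlonglongrightarrow> x \<and> (\<lambda>j. f (X (r j))) \<longlonglongrightarrow> f x"
proof -
  let ?S = "range (\<lambda>x. (x, f x))"
  obtain T where T: "countable T" "T \<subseteq> ?S" "?S \<subseteq> closure T"
    by (rule separable)
  have "T \<noteq> {}" using T(3) by auto
  define X where "X n = fst (from_nat_into T n)" for n
  have X: "from_nat_into T n = (X n, f (X n))" for n
    using from_nat_into[OF \<open>T \<noteq> {}\<close>, of n] T(2) by (auto simp: X_def)
  have "\<exists>r. (\<lambda>j. X (r j)) \<longlonglongrightarrow> x \<and> (\<lambda>j. f (X (r j))) \<longlonglongrightarrow> f x" for x
  proof -
    have "(x, f x) \<in> closure T" using T(3) by auto
    then obtain y where y: "\<And>j. y j \<in> T" "y \<longlonglongrightarrow> (x, f x)"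
      unfolding closure_sequential by blast
    have "\<exists>n. y j = (X n, f (X n))" for j
      using from_nat_into_surj[OF T(1) y(1)[of j]] X by metis
    then obtain r where "\<And>j. y j = (X (r j), f (X (r j)))" by metis
    then have "y = (\<lambda>j. (X (r j), f (X (r j))))" by blast
    then show ?thesis
      using tendsto_fst[OF y(2)] tendsto_snd[OF y(2)] by auto
  qed
  then show thesis by (rule that)
qed

text \<open>Tossing a coin of bias \<open>\<epsilon>\<close> to choose between \<open>p\<close> and
  \<open>q\<close> realizes the convex combination; this gives convexity of the set of attainable
  covering vectors.\<close>

lemma expectation_bernoulli_mixture:
  fixes h :: "'a \<Rightarrow> real"
  assumes "0 \<le> \<epsilon>" "\<epsilon> \<le> 1" and h: "\<And>x. 0 \<le> h x" "\<And>x. h x \<le> B"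
  shows "measure_pmf.expectation (bernoulli_pmf \<epsilon> \<bind> (\<lambda>b. if b then q else p)) h =
    (1 - \<epsilon>) * measure_pmf.expectation p h + \<epsilon> * measure_pmf.expectation q h"
proof -
  have int: "integrable (measure_pmf r) h" for r
    using h by (intro measure_pmf.integrable_const_bound[where B = B]) auto
  have nn: "0 \<le> measure_pmf.expectation r h" for r
    using h by simp
  have "ennreal (measure_pmf.expectation (bernoulli_pmf \<epsilon> \<bind> (\<lambda>b. if b then q else p)) h) =
      (\<integral>\<^sup>+ x. ennreal (h x) \<partial>measure_pmf (bernoulli_pmf \<epsilon> \<bind> (\<lambda>b. if b then q else p)))"
    using h by (intro nn_integral_eq_integral[OF int, symmetric]) auto
  also have "\<dots> = ennreal (measure_pmf.expectation q h) * ennreal \<epsilon>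
      + ennreal (measure_pmf.expectation p h) * ennreal (1 - \<epsilon>)"
    using assms by (simp add: nn_integral_eq_integral[OF int])
  also have "\<dots> = ennreal ((1 - \<epsilon>) * measure_pmf.expectation p h + \<epsilon> * measure_pmf.expectation q h)"
    using assms nn by (simp add: ennreal_mult[symmetric] ennreal_plus[symmetric] mult_ac add_ac
        del: ennreal_plus)
  finally show ?thesis
    using assms nn by (subst (asm) ennreal_inj) auto
qed

text \<open>Put mass \<open>w i\<close> at \<open>X i\<close>. The reflection of \<open>h\<close>
  turns the convolution at \<open>t\<close> into the sum of the \<open>w i * h (X i - t)\<close>.
  Pushing forward along \<open>X\<close> adds up the weights of coinciding points.\<close>

lemma weighted_points_dual_feasible:
  fixes X :: "'i \<Rightarrow> 'a::euclidean_space"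
  assumes "finite I" and w: "\<And>i. i \<in> I \<Longrightarrow> 0 \<le> w i"
    and [measurable]: "f \<in> borel_measurable borel" "h \<in> borel_measurable borel"
    and f: "\<And>x. 0 \<le> f x" and h: "\<And>x. 0 \<le> h x"
    and le: "\<And>t. (\<Sum>i\<in>I. w i * h (X i - t)) \<le> 1"
  obtains \<rho> where "borel_measure \<rho>" "finite_measure \<rho>"
    "\<And>x. measure_conv \<rho> (\<lambda>x. h (- x)) x \<le> 1"
    "(\<integral>\<^sup>+ x. ennreal (f x) \<partial>\<rho>) = ennreal (\<Sum>i\<in>I. w i * f (X i))"
proof
  define \<rho> where "\<rho> = distr (point_measure I (\<lambda>i. ennreal (w i))) borel X"
  have nn_integral: "(\<integral>\<^sup>+ x. ennreal (\<phi> x) \<partial>\<rho>) = ennreal (\<Sum>i\<in>I. w i * \<phi> (X i))"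
    if [measurable]: "\<phi> \<in> borel_measurable borel" and "\<And>x. 0 \<le> \<phi> x" for \<phi>
    using \<open>finite I\<close> w that(2)
    by (simp add: \<rho>_def nn_integral_distr nn_integral_point_measure_finite ennreal_mult[symmetric]
        sum_ennreal cong: sum.cong)
  show "borel_measure \<rho>"
    by (simp add: \<rho>_def borel_measure_def)
  show "finite_measure \<rho>"
    by (rule finite_measureI)
       (use nn_integral[of "\<lambda>_. 1"] in \<open>simp add: \<rho>_def\<close>)
  show "measure_conv \<rho> (\<lambda>x. h (- x)) t \<le> 1" for t
    using le[of t] h by (simp add: measure_conv_def nn_integral)
  show "(\<integral>\<^sup>+ x. ennreal (f x) \<partial>\<rho>) = ennreal (\<Sum>i\<in>I. w i * f (X i))"
    using f by (simp add: nn_integral)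
qed

text \<open>Separate the convex set of covering vectors of mass \<open>m\<close> from the orthant
  above \<open>f\<close>. Testing the separation on point masses \<open>return_pmf t\<close> bounds
  the weighted sum at every \<open>t\<close>, and scaling by \<open>m / b\<close> turns this bound
  into 1 and the strict separation into the value above \<open>m\<close>.\<close>

lemma finite_covering_duality:
  fixes X :: "'i \<Rightarrow> 'a::euclidean_space"
  assumes "finite I" and h: "h \<in> C0_functions" "\<And>x. 0 \<le> h x" and "0 < m" and "0 < \<delta>"
    and far: "\<And>p :: 'a pmf. \<delta> \<le>
      (\<Sum>i\<in>I. (max 0 (f (X i) - m * measure_pmf.expectation p (\<lambda>y. h (X i - y))))\<^sup>2)"
  obtains w where "\<And>i. 0 \<le> w i" "\<And>t. (\<Sum>i\<in>I. w i * h (X i - t)) \<le> 1"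
    "m < (\<Sum>i\<in>I. w i * f (X i))"
proof -
  let ?v = "\<lambda>p i. m * measure_pmf.expectation p (\<lambda>y. h (X i - y))"
  obtain B where B: "0 < B" "\<And>x. \<bar>h x\<bar> \<le> B"
    using C0_functions_bounded[OF h(1)] by metis
  then have hB: "h x \<le> B" for x
    by (metis abs_le_D1)
  note [measurable] = C0_functions_measurable[OF h(1)]
  obtain \<rho> b where \<rho>: "\<And>i. 0 \<le> \<rho> i" and b: "0 < b" "b < (\<Sum>i\<in>I. \<rho> i * f (X i))"
    and le: "\<And>v. v \<in> range ?v \<Longrightarrow> (\<Sum>i\<in>I. \<rho> i * v i) \<le> b"
  proof (rule separation_from_orthant[of I "range ?v" "m * B" \<delta> "\<lambda>i. f (X i)"])
    fix v w :: "'i \<Rightarrow> real" and \<epsilon> :: real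
    assume "v \<in> range ?v" "w \<in> range ?v" and \<epsilon>: "0 < \<epsilon>" "\<epsilon> \<le> 1"
    then obtain p q where pq: "v = ?v p" "w = ?v q" by auto
    have "(\<lambda>i. (1 - \<epsilon>) * v i + \<epsilon> * w i) = ?v (bernoulli_pmf \<epsilon> \<bind> (\<lambda>b. if b then q else p))"
      using \<epsilon> h(2) hB
      by (subst expectation_bernoulli_mixture[where B = B]) (auto simp: pq algebra_simps)
    then show "(\<lambda>i. (1 - \<epsilon>) * v i + \<epsilon> * w i) \<in> range ?v" by blast
  next
    fix v i
    assume "v \<in> range ?v"
    then obtain p where v: "v = ?v p" by auto
    have "measure_pmf.expectation p (\<lambda>y. h (X i - y)) \<le> measure_pmf.expectation p (\<lambda>_. B)"
      using h(2) hB \<open>0 < B\<close>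
      by (intro integral_mono measure_pmf.integrable_const_bound[where B = B]) auto
    then show "0 \<le> v i \<and> v i \<le> m * B"
      using \<open>0 < m\<close> h(2) by (simp add: v)
  qed (use assms in auto)
  define w where "w i = m / b * \<rho> i" for i
  show thesis
  proof (rule that[of w])
    show "0 \<le> w i" for i
      using \<rho> b \<open>0 < m\<close> by (simp add: w_def)
    show "(\<Sum>i\<in>I. w i * h (X i - t)) \<le> 1" for t
    proof -
      have "m * (\<Sum>i\<in>I. \<rho> i * h (X i - t)) \<le> b"
        using le[OF rangeI, of "return_pmf t"] by (simp add: sum_distrib_left mult_ac)
      then have "m / b * (\<Sum>i\<in>I. \<rho> i * h (X i - t)) \<le> 1"
        using b by (simp add: field_simps)
      then show ?thesis
        by (simp add: w_def sum_distrib_left mult_ac)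
    qed
    have "m * 1 < m * ((\<Sum>i\<in>I. \<rho> i * f (X i)) / b)"
      using \<open>0 < m\<close> b by (intro mult_strict_left_mono) auto
    then show "m < (\<Sum>i\<in>I. w i * f (X i))"
      by (simp add: w_def sum_distrib_left sum_divide_distrib mult_ac)
  qed
qed

lemma isCont_C0_convolution:
  fixes h :: "'a::euclidean_space \<Rightarrow> real"
  assumes h: "h \<in> C0_functions" and "finite_measure \<mu>" and [measurable_cong]: "sets \<mu> = sets borel"
  shows "isCont (\<lambda>x. \<integral>y. h (x - y) \<partial>\<mu>) x"
proof -
  interpret finite_measure \<mu> by fact
  note [measurable] = C0_functions_measurable[OF h]
  obtain B where B: "\<And>x. \<bar>h x\<bar> \<le> B"
    using C0_functions_bounded[OF h] by metis
  have cont: "isCont h z" for z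
    using C0_functions_continuous[OF h, of UNIV] by (simp add: continuous_on_eq_continuous_at)
  show ?thesis
    unfolding continuous_at_sequentially comp_def
  proof (intro allI impI)
    fix u
    assume "u \<longlonglongrightarrow> x"
    then have "(\<lambda>j. h (u j - y)) \<longlonglongrightarrow> h (x - y)" for y
      by (intro isCont_tendsto_compose[OF cont] tendsto_intros)
    then show "(\<lambda>j. \<integral>y. h (u j - y) \<partial>\<mu>) \<longlonglongrightarrow> (\<integral>y. h (x - y) \<partial>\<mu>)"
      using B by (intro integral_dominated_convergence[where w = "\<lambda>_. B"]) auto
  qed
qed

section \<open>Coverings by limits of functions vanishing at infinity\<close>

locale C0_approximation =
  fixes f g :: "'a::euclidean_space \<Rightarrow> real" and G :: "nat \<Rightarrow> 'a \<Rightarrow> real"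
  assumes f_meas [measurable]: "f \<in> borel_measurable borel" and f_nonneg: "\<And>x. 0 \<le> f x"
    and g_meas [measurable]: "g \<in> borel_measurable borel" and g_nonneg: "\<And>x. 0 \<le> g x"
    and G_C0: "\<And>k. G k \<in> C0_functions"
    and G_noninc: "\<And>x. decseq (\<lambda>k. G k x)"
    and G_lim: "\<And>x. (\<lambda>k. G k x) \<longlonglongrightarrow> g x"
begin

lemma g_le_G: "g x \<le> G k x"
  using decseq_ge[OF G_noninc G_lim] .

lemma G_nonneg: "0 \<le> G k x"
  using g_nonneg[of x] g_le_G[of x k] by simp

lemma G_meas [measurable]: "G k \<in> borel_measurable borel"
  by (rule C0_functions_measurable[OF G_C0])

text \<open>\<open>G 0\<close> dominates every \<open>G k\<close>, so one constant serves all
  \<open>k\<close> as majorant for dominated convergence.\<close>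

lemma G_bounded:
  obtains B where "0 < B" "\<And>k x. G k x \<le> B"
proof -
  obtain B where B: "0 < B" "\<And>x. \<bar>G 0 x\<bar> \<le> B"
    using C0_functions_bounded[OF G_C0] by metis
  have "G k x \<le> B" for k x
    using decseqD[OF G_noninc, of 0 k x] B(2)[of x] by simp
  then show thesis using that B(1) by blast
qed

text \<open>Two limits in this order: for fixed \<open>k\<close> along sample points approaching
  \<open>x\<close>, by continuity of the convolution with \<open>G k\<close>; then \<open>k\<close>
  to infinity under the integral.\<close>

lemma covering_measure_from_limits:
  fixes \<mu> :: "'a measure"
  assumes "finite_measure \<mu>" and [measurable_cong]: "sets \<mu> = sets borel" and "0 \<le> m"
    and X: "\<And>x. \<exists>r. (\<lambda>j. X (r j)) \<longlonglongrightarrow> x \<and> (\<lambda>j. f (X (r j))) \<longlonglongrightarrow> f x"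
    and le: "\<And>i k. f (X i) \<le> m * (\<integral>y. G k (X i - y) \<partial>\<mu>)"
  shows "covering_measure (scale_measure (ennreal m) \<mu>) f g"
proof -
  interpret finite_measure \<mu> by fact
  obtain B where B: "\<And>k x. G k x \<le> B"
    using G_bounded by blast
  have G_le: "f x \<le> m * (\<integral>y. G k (x - y) \<partial>\<mu>)" for x k
  proof -
    obtain r where r: "(\<lambda>j. X (r j)) \<longlonglongrightarrow> x" "(\<lambda>j. f (X (r j))) \<longlonglongrightarrow> f x"
      using X by blast
    have "(\<lambda>j. m * (\<integral>y. G k (X (r j) - y) \<partial>\<mu>)) \<longlonglongrightarrow> m * (\<integral>y. G k (x - y) \<partial>\<mu>)"
      by (intro tendsto_intros isCont_tendsto_compose[OF isCont_C0_convolution r(1)])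
         (fact | rule G_C0)+
    then show ?thesis
      using r(2) le by (intro LIMSEQ_le[of "\<lambda>j. f (X (r j))"]) auto
  qed
  have int: "integrable \<mu> (\<lambda>y. g (x - y))" for x
    using g_nonneg order_trans[OF g_le_G B] by (intro integrable_const_bound[where B = B]) auto
  have g_le: "f x \<le> m * (\<integral>y. g (x - y) \<partial>\<mu>)" for x
  proof (rule LIMSEQ_le_const)
    show "(\<lambda>k. m * (\<integral>y. G k (x - y) \<partial>\<mu>)) \<longlonglongrightarrow> m * (\<integral>y. g (x - y) \<partial>\<mu>)"
      using B G_nonneg G_lim
      by (intro tendsto_intros integral_dominated_convergence[where w = "\<lambda>_. B"]) auto
  qed (use G_le in auto)
  show ?thesis
    unfolding covering_measure_def borel_measure_def
  proof (intro conjI allI)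
    show "sets (scale_measure (ennreal m) \<mu>) = sets borel" by (simp add: assms)
    fix x
    have "measure_conv (scale_measure (ennreal m) \<mu>) g x = ennreal (m * (\<integral>y. g (x - y) \<partial>\<mu>))"
      using g_nonneg \<open>0 \<le> m\<close>
      by (simp add: measure_conv_def nn_integral_scale_measure nn_integral_eq_integral[OF int]
          ennreal_mult)
    then show "ennreal (f x) \<le> measure_conv (scale_measure (ennreal m) \<mu>) g x"
      using g_le by (simp add: ennreal_leI)
  qed
qed

lemma covering_or_dual_pos:
  assumes "0 < m"
  shows "(\<exists>\<mu>. covering_measure \<mu> f g \<and> emeasure \<mu> UNIV \<le> ennreal m) \<or>
    (\<exists>k \<rho>. borel_measure \<rho> \<and> finite_measure \<rho> \<and> (\<forall>x. measure_conv \<rho> (\<lambda>x. G k (- x)) x \<le> 1) \<and>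
      ennreal m < (\<integral>\<^sup>+ x. ennreal (f x) \<partial>\<rho>))"
proof -
  obtain X :: "nat \<Rightarrow> 'a"
    where X: "\<And>x. \<exists>r. (\<lambda>j. X (r j)) \<longlonglongrightarrow> x \<and> (\<lambda>j. f (X (r j))) \<longlonglongrightarrow> f x"
    using dense_graph_sequence[of f] by metis
  \<comment> \<open>The shortfall at \<open>X i\<close> when \<open>f\<close> is covered by
    \<open>G j\<close> with \<open>m\<close> times the probability measure \<open>p\<close>.\<close>
  define d where "d p j i = f (X i) - m * measure_pmf.expectation p (\<lambda>y. G j (X i - y))"
    for p :: "'a pmf" and j i
  show ?thesis
  proof (cases "\<exists>j. \<exists>\<delta>>0. \<forall>p. \<delta> \<le> (\<Sum>i\<le>j. (max 0 (d p j i))\<^sup>2)")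
    case True
    then obtain j \<delta> where far: "0 < \<delta>" "\<And>p. \<delta> \<le> (\<Sum>i\<le>j. (max 0 (d p j i))\<^sup>2)" by blast
    obtain w where w: "\<And>i. 0 \<le> w i" "\<And>t. (\<Sum>i\<le>j. w i * G j (X i - t)) \<le> 1"
      "m < (\<Sum>i\<le>j. w i * f (X i))"
      using finite_covering_duality[OF finite_atMost G_C0 G_nonneg assms far[unfolded d_def]] by blast
    obtain \<rho> where "borel_measure \<rho>" "finite_measure \<rho>"
      "\<And>x. measure_conv \<rho> (\<lambda>x. G j (- x)) x \<le> 1"
      "(\<integral>\<^sup>+ x. ennreal (f x) \<partial>\<rho>) = ennreal (\<Sum>i\<le>j. w i * f (X i))"
      using weighted_points_dual_feasible[OF finite_atMost w(1) f_meas G_meas f_nonneg G_nonneg w(2)]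
      by blast
    then show ?thesis
      using w(3) assms by (intro disjI2 exI[of _ j] exI[of _ \<rho>]) (auto simp: ennreal_lessI)
  next
    case False
    have "\<exists>p. (\<Sum>i\<le>j. (max 0 (d p j i))\<^sup>2) < 1 / Suc j" for j
      using False by (meson not_le of_nat_0_less_iff zero_less_Suc zero_less_divide_1_iff)
    then obtain p where p: "\<And>j. (\<Sum>i\<le>j. (max 0 (d (p j) j i))\<^sup>2) < 1 / Suc j" by metis
    \<comment> \<open>\<open>G j \<le> G k\<close> for \<open>k \<le> j\<close>, so an almost
      solution for \<open>G j\<close> is one for each earlier \<open>G k\<close>. This frees
      \<open>k\<close> from \<open>j\<close>, since the vague limit needs a fixed test
      function.\<close>
    have d_le: "d (p j) k i \<le> sqrt (1 / Suc j)" if "i \<le> j" "k \<le> j" for i j k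
    proof -
      obtain B where B: "\<And>k x. G k x \<le> B"
        using G_bounded by blast
      have "measure_pmf.expectation (p j) (\<lambda>y. G j (X i - y))
          \<le> measure_pmf.expectation (p j) (\<lambda>y. G k (X i - y))"
        using B G_nonneg decseqD[OF G_noninc \<open>k \<le> j\<close>]
        by (intro integral_mono measure_pmf.integrable_const_bound[where B = B]) auto
      then have "d (p j) k i \<le> d (p j) j i"
        using assms by (simp add: d_def)
      also have "\<dots> \<le> sqrt ((max 0 (d (p j) j i))\<^sup>2)"
        by simp
      also have "\<dots> \<le> sqrt (\<Sum>i\<le>j. (max 0 (d (p j) j i))\<^sup>2)"
        using \<open>i \<le> j\<close> by (intro real_sqrt_le_mono member_le_sum) auto
      also have "\<dots> \<le> sqrt (1 / Suc j)"
        using p[of j] by (intro real_sqrt_le_mono) simp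
      finally show ?thesis .
    qed
    obtain r \<mu> where r: "strict_mono r" and \<mu>: "sets \<mu> = sets borel" "emeasure \<mu> UNIV \<le> 1"
      and lim: "\<And>h. h \<in> C0_functions \<Longrightarrow>
         (\<lambda>j. measure_pmf.expectation (p (r j)) h) \<longlonglongrightarrow> (\<integral>x. h x \<partial>\<mu>)"
      using pmf_vague_compactness[of p] by metis
    have space: "space \<mu> = UNIV"
      using sets_eq_imp_space_eq[OF \<mu>(1)] by simp
    have fin: "finite_measure \<mu>"
      using \<mu>(2) by (intro finite_measureI) (auto simp: space top_unique)
    have "f (X i) - m * (\<integral>y. G k (X i - y) \<partial>\<mu>) \<le> 0" for i k
    proof (rule LIMSEQ_le)
      show "(\<lambda>j. d (p (r j)) k i) \<longlonglongrightarrow> f (X i) - m * (\<integral>y. G k (X i - y) \<partial>\<mu>)"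
        unfolding d_def by (intro tendsto_intros lim C0_functions_reflect_shift G_C0)
      have "(\<lambda>j. sqrt (1 / Suc j)) \<longlonglongrightarrow> sqrt 0"
        by (intro tendsto_real_sqrt lim_1_over_n[THEN LIMSEQ_Suc])
      then show "(\<lambda>j. sqrt (1 / Suc (r j))) \<longlonglongrightarrow> 0"
        using LIMSEQ_subseq_LIMSEQ[OF _ r] by (simp add: comp_def)
      show "\<exists>N. \<forall>j\<ge>N. d (p (r j)) k i \<le> sqrt (1 / Suc (r j))"
      proof (intro exI allI impI)
        fix j
        assume "max i k \<le> j"
        moreover have "j \<le> r j" using r by (rule strict_mono_imp_increasing)
        ultimately show "d (p (r j)) k i \<le> sqrt (1 / Suc (r j))"
          by (intro d_le) auto
      qed
    qed
    then have "covering_measure (scale_measure (ennreal m) \<mu>) f g"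
      using assms by (intro covering_measure_from_limits[OF fin \<mu>(1) _ X]) auto
    moreover have "emeasure (scale_measure (ennreal m) \<mu>) UNIV \<le> ennreal m"
      using mult_left_mono[OF \<mu>(2), of "ennreal m"] by simp
    ultimately show ?thesis by blast
  qed
qed

text \<open>At \<open>m = 0\<close> the scaling by \<open>m / b\<close> would give zero weights.
  There either \<open>f\<close> vanishes and the null measure covers it, or a point mass
  \<open>1 / B\<close> at some \<open>z\<close> with \<open>f z > 0\<close> is dual
  feasible.\<close>

lemma covering_or_dual:
  assumes "0 \<le> m"
  shows "(\<exists>\<mu>. covering_measure \<mu> f g \<and> emeasure \<mu> UNIV \<le> ennreal m) \<or>
    (\<exists>k \<rho>. borel_measure \<rho> \<and> finite_measure \<rho> \<and> (\<forall>x. measure_conv \<rho> (\<lambda>x. G k (- x)) x \<le> 1) \<and>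
      ennreal m < (\<integral>\<^sup>+ x. ennreal (f x) \<partial>\<rho>))"
proof (cases "m = 0")
  case False
  then show ?thesis using assms covering_or_dual_pos by simp
next
  case [simp]: True
  show ?thesis
  proof (cases "\<forall>x. f x = 0")
    case True
    then have "covering_measure (null_measure borel) f g"
      by (simp add: covering_measure_def borel_measure_def)
    then show ?thesis by (intro disjI1 exI[of _ "null_measure borel"]) simp
  next
    case False
    then obtain z where "f z \<noteq> 0" by blast
    then have z: "0 < f z" using f_nonneg[of z] by simp
    obtain B where B: "0 < B" "\<And>k x. G k x \<le> B"
      using G_bounded by blast
    have "(\<Sum>i\<in>{z}. 1 / B * G 0 (i - t)) \<le> 1" for t
      using B by (simp add: field_simps)
    then obtain \<rho> where "borel_measure \<rho>" "finite_measure \<rho>"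
      "\<And>x. measure_conv \<rho> (\<lambda>x. G 0 (- x)) x \<le> 1"
      "(\<integral>\<^sup>+ x. ennreal (f x) \<partial>\<rho>) = ennreal (\<Sum>i\<in>{z}. 1 / B * f i)"
      using weighted_points_dual_feasible[of "{z}" "\<lambda>_. 1 / B" f "G 0" "\<lambda>x. x"] B(1)
        f_nonneg G_nonneg by auto
    then show ?thesis
      using z B by (intro disjI2 exI[of _ 0] exI[of _ \<rho>]) (auto intro: ennreal_lessI)
  qed
qed

end

section \<open>Weak duality and the conclusion\<close>

lemma measure_conv_mono:
  "(\<And>x. g x \<le> h x) \<Longrightarrow> measure_conv \<mu> g x \<le> measure_conv \<mu> h x"
  unfolding measure_conv_def by (intro nn_integral_mono ennreal_leI) auto

lemma N1_antimono:
  "(\<And>x. g x \<le> h x) \<Longrightarrow> N1 f h \<le> N1 f g"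
  unfolding N1_def covering_measure_def
  by (intro Inf_superset_mono) (blast intro: order_trans[OF _ measure_conv_mono])

text \<open>Integrate the covering inequality against \<open>\<rho>\<close> and exchange the
  integrals: the inner one becomes the convolution of \<open>\<rho>\<close> with the reflected
  \<open>g\<close>, which is at most 1. Only finite \<open>\<mu>\<close> need an argument, so
  Tonelli's theorem applies.\<close>

lemma weak_duality:
  fixes f g :: "'a::euclidean_space \<Rightarrow> real"
  assumes [measurable]: "g \<in> borel_measurable borel"
    and \<rho>: "borel_measure \<rho>" "sigma_finite_measure \<rho>" "\<And>x. measure_conv \<rho> (\<lambda>x. g (- x)) x \<le> 1"
  shows "(\<integral>\<^sup>+ x. ennreal (f x) \<partial>\<rho>) \<le> N1 f g"
  unfolding N1_def
proof (intro Inf_greatest, clarify)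
  fix \<mu> :: "'a measure"
  assume cov: "covering_measure \<mu> f g"
  have [measurable_cong]: "sets \<mu> = sets borel" "sets \<rho> = sets borel"
    using cov \<rho>(1) by (simp_all add: covering_measure_def borel_measure_def)
  have space: "space \<mu> = UNIV"
    using sets_eq_imp_space_eq[of \<mu> borel] cov by (simp add: covering_measure_def borel_measure_def)
  show "(\<integral>\<^sup>+ x. ennreal (f x) \<partial>\<rho>) \<le> emeasure \<mu> UNIV"
  proof (cases "emeasure \<mu> UNIV = \<infinity>")
    case False
    interpret \<mu>: finite_measure \<mu>
      using False by (intro finite_measureI) (simp add: space)
    interpret \<rho>: sigma_finite_measure \<rho> by fact
    interpret pair_sigma_finite \<mu> \<rho> ..
    have "(\<integral>\<^sup>+ x. ennreal (f x) \<partial>\<rho>) \<le> (\<integral>\<^sup>+ x. (\<integral>\<^sup>+ t. ennreal (g (x - t)) \<partial>\<mu>) \<partial>\<rho>)"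
      using cov by (intro nn_integral_mono) (simp add: covering_measure_def measure_conv_def)
    also have "\<dots> = (\<integral>\<^sup>+ t. (\<integral>\<^sup>+ x. ennreal (g (x - t)) \<partial>\<rho>) \<partial>\<mu>)"
      by (rule Fubini') measurable
    also have "\<dots> \<le> (\<integral>\<^sup>+ t. 1 \<partial>\<mu>)"
      using \<rho>(3) by (intro nn_integral_mono) (simp add: measure_conv_def)
    finally show ?thesis by (simp add: space)
  qed simp
qed

theorem theorem1p4:
  fixes f g :: "real ^ 'n \<Rightarrow> real"
    and G :: "nat \<Rightarrow> real ^ 'n \<Rightarrow> real"
  assumes f_meas: "f \<in> borel_measurable borel" and f_nonneg: "\<And>x. 0 \<le> f x"
    and g_meas: "g \<in> borel_measurable borel" and g_nonneg: "\<And>x. 0 \<le> g x"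
    and G_C0: "\<And>k. G k \<in> C0_functions"
    and G_noninc: "\<And>x. decseq (\<lambda>k. G k x)"
    and G_lim: "\<And>x. (\<lambda>k. G k x) \<longlonglongrightarrow> g x"
    and N_fin: "N1 f g < \<infinity>"
  shows "M1 f (\<lambda>x. g (- x)) = N1 f g
    \<and> (\<lambda>k. N1 f (G k)) \<longlonglongrightarrow> N1 f g
    \<and> (\<exists>\<mu>. covering_measure \<mu> f g \<and> emeasure \<mu> UNIV = N1 f g)"
proof -
  interpret C0_approximation f g G
    by unfold_locales fact+
  have N1_le: "N1 f g \<le> emeasure \<mu> UNIV" if "covering_measure \<mu> f g" for \<mu>
    unfolding N1_def using that by (intro Inf_lower) blast
  have dual_le: "(\<integral>\<^sup>+ x. ennreal (f x) \<partial>\<rho>) \<le> N1 f (G k)"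
    "(\<integral>\<^sup>+ x. ennreal (f x) \<partial>\<rho>) \<le> M1 f (\<lambda>x. g (- x))"
    if \<rho>: "borel_measure \<rho>" "finite_measure \<rho>" "\<And>x. measure_conv \<rho> (\<lambda>x. G k (- x)) x \<le> 1"
    for k \<rho>
  proof -
    interpret finite_measure \<rho> by fact
    have sf: "sigma_finite_measure \<rho>" ..
    show "(\<integral>\<^sup>+ x. ennreal (f x) \<partial>\<rho>) \<le> N1 f (G k)"
      by (rule weak_duality[OF G_meas \<rho>(1) sf \<rho>(3)])
    have "measure_conv \<rho> (\<lambda>x. g (- x)) x \<le> 1" for x
      by (rule order_trans[OF measure_conv_mono \<rho>(3)]) (rule g_le_G)
    then show "(\<integral>\<^sup>+ x. ennreal (f x) \<partial>\<rho>) \<le> M1 f (\<lambda>x. g (- x))"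
      unfolding M1_def using \<rho>(1) sf by (intro Sup_upper) blast
  qed
  have N1_G_le: "N1 f (G k) \<le> N1 f g" for k
    by (rule N1_antimono) (rule g_le_G)
  \<comment> \<open>No covering has mass \<open>m\<close> or less, so the alternative yields a
    \<open>\<rho>\<close> with integral above \<open>m\<close>; it bounds both quantities from
    below.\<close>
  have no_dual_bound: "\<exists>k. m < N1 f (G k)" "m < M1 f (\<lambda>x. g (- x))" if "m < N1 f g" for m
  proof -
    obtain m' where m': "m = ennreal m'" "0 \<le> m'"
      using \<open>m < N1 f g\<close> by (cases m) auto
    have "\<not> (\<exists>\<mu>. covering_measure \<mu> f g \<and> emeasure \<mu> UNIV \<le> ennreal m')"
      using N1_le that unfolding m' by (meson leD order_trans)
    then show "\<exists>k. m < N1 f (G k)" "m < M1 f (\<lambda>x. g (- x))"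
      using covering_or_dual[OF m'(2)] dual_le less_le_trans unfolding m' by meson+
  qed
  have "M1 f (\<lambda>x. g (- x)) \<le> N1 f g"
    unfolding M1_def by (intro Sup_least) (auto intro: weak_duality[OF g_meas])
  moreover have "N1 f g \<le> M1 f (\<lambda>x. g (- x))"
    using no_dual_bound(2) by (meson less_irrefl not_le)
  moreover have "(\<lambda>k. N1 f (G k)) \<longlonglongrightarrow> N1 f g"
  proof -
    have "incseq (\<lambda>k. N1 f (G k))"
      by (intro incseq_SucI N1_antimono) (rule decseq_SucD[OF G_noninc])
    moreover have "(SUP k. N1 f (G k)) = N1 f g"
      using N1_G_le no_dual_bound(1) by (intro SUP_eqI) (auto, meson leD not_le)
    ultimately show ?thesis
      using LIMSEQ_SUP by metis
  qed
  moreover have "\<exists>\<mu>. covering_measure \<mu> f g \<and> emeasure \<mu> UNIV = N1 f g"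
  proof -
    obtain m where m: "N1 f g = ennreal m" "0 \<le> m"
      using N_fin by (cases "N1 f g") auto
    \<comment> \<open>At the optimal mass a dual \<open>\<rho>\<close> would push
      \<open>N1 f (G k)\<close> above \<open>N1 f g\<close>, so the other alternative, a covering,
      must hold.\<close>
    have "\<not> ennreal m < (\<integral>\<^sup>+ x. ennreal (f x) \<partial>\<rho>)"
      if "borel_measure \<rho>" "finite_measure \<rho>" "\<forall>x. measure_conv \<rho> (\<lambda>x. G k (- x)) x \<le> 1" for k \<rho>
      using order_trans[OF dual_le(1) N1_G_le] that by (auto simp: m not_less)
    then obtain \<mu> where "covering_measure \<mu> f g" "emeasure \<mu> UNIV \<le> N1 f g"
      using covering_or_dual[OF m(2)] unfolding m(1) by blast
    then show ?thesis using N1_le antisym by blast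
  qed
  ultimately show ?thesis by (auto intro: antisym)
qed

end
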